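(* Let $b>0$, $c>0$ and $d\ge 0$ be real constants. Then there exist $\varepsilon_0>0$ and $C>0$ (depending only on $b,c,d$) such that the following holds for all $\varepsilon\in(0,\varepsilon_0]$, all $f\in L^\infty(0,2)$, and all $\beta,\delta\in\mathbb{R}$. Let $u=u_1\chi_{(0,1)}+u_2\chi_{(1,2)}$, where $\chi_D$ denotes the characteristic function of $D$, and where $u_1,u_2$ satisfy $$-\varepsilon u_1''(x)-b\,u_1'(x)+c\,u_1(x)=f(x),\quad x\in(0,1),\qquad u_1(0)=0,\quad u_1(1)=\alpha,$$ $$-\varepsilon u_2''(x)-b\,u_2'(x)+c\,u_2(x)=f(x)-d\,u_1(x-1),\quad x\in(1,2),\qquad u_2(1)=\alpha+\delta,\quad u_2(2)=\beta,$$ with $\alpha\in\mathbb{R}$ chosen such that $u_1'(1^-)=u_2'(1^+)$. Then $$\|u\|_{L^\infty(0,2)}\le C\left(\|f\|_{L^\infty(0,2)}+|\beta|+|\delta|\right).$$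
   Context: The parameter $\varepsilon$ is a singular perturbation parameter, $0<\varepsilon\ll 1$; the point of the estimate is that the constant $C$ is independent of $\varepsilon$ (and of $f,\beta,\delta$). Differential equations with right-hand side in $L^\infty$ are understood almost everywhere, with $u_1\in W^{2,\infty}(0,1)$ and $u_2\in W^{2,\infty}(1,2)$. $u_1'(1^-)$ and $u_2'(1^+)$ denote one-sided limits of the derivatives at $x=1$. *)

theory Defs
  imports "HOL-Analysis.Analysis" "HOL-Probability.Essential_Supremum"
begin

text \<open>The \<open>L\<^sup>\<infinity>(l,r)\<close> norm takes the value \<open>\<infinity>\<close> on functions that are not
  (Lebesgue) measurable or not essentially bounded on \<open>(l,r)\<close>.\<close>

definition Linf_norm :: "real \<Rightarrow> real \<Rightarrow> (real \<Rightarrow> real) \<Rightarrow> ereal" where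
  "Linf_norm l r f = esssup (lebesgue_on {l<..<r}) (\<lambda>x. ereal \<bar>f x\<bar>)"

definition Linf :: "real \<Rightarrow> real \<Rightarrow> (real \<Rightarrow> real) set" where
  "Linf l r = {f. f \<in> borel_measurable (lebesgue_on {l<..<r}) \<and> Linf_norm l r f < \<infinity>}"

text \<open>Smooth functions on the real line with compact support in \<open>(l,r)\<close>.\<close>

definition test_function :: "real \<Rightarrow> real \<Rightarrow> (real \<Rightarrow> real) \<Rightarrow> bool" where
  "test_function l r \<phi> \<longleftrightarrow>
     (\<forall>k x. (deriv ^^ k) \<phi> differentiable (at x)) \<and>
     (\<exists>K. compact K \<and> K \<subseteq> {l<..<r} \<and> (\<forall>x. x \<notin> K \<longrightarrow> \<phi> x = 0))"

definition locally_integrable :: "real \<Rightarrow> real \<Rightarrow> (real \<Rightarrow> real) \<Rightarrow> bool" where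
  "locally_integrable l r f \<longleftrightarrow>
     (\<forall>K. compact K \<and> K \<subseteq> {l<..<r} \<longrightarrow> integrable (lebesgue_on K) f)"

definition weak_deriv :: "real \<Rightarrow> real \<Rightarrow> (real \<Rightarrow> real) \<Rightarrow> (real \<Rightarrow> real) \<Rightarrow> bool" where
  "weak_deriv l r u v \<longleftrightarrow>
     locally_integrable l r u \<and> locally_integrable l r v \<and>
     (\<forall>\<phi>. test_function l r \<phi> \<longrightarrow>
        (LINT x|lebesgue_on {l<..<r}. u x * deriv \<phi> x) =
        - (LINT x|lebesgue_on {l<..<r}. v x * \<phi> x))"

text \<open>\<open>u \<in> W\<^sup>2\<^sup>,\<^sup>\<infinity>(l,r)\<close>, with first and second weak derivatives \<open>v\<close> and \<open>w\<close>
  (which are determined almost everywhere by \<open>u\<close>).\<close>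

definition W2inf :: "real \<Rightarrow> real \<Rightarrow> (real \<Rightarrow> real) \<Rightarrow> (real \<Rightarrow> real) \<Rightarrow> (real \<Rightarrow> real) \<Rightarrow> bool" where
  "W2inf l r u v w \<longleftrightarrow>
     u \<in> Linf l r \<and> v \<in> Linf l r \<and> w \<in> Linf l r \<and> weak_deriv l r u v \<and> weak_deriv l r v w"

text \<open>The problem \<open>-\<epsilon> u'' - b u' + c u = g\<close> almost everywhere in \<open>(l,r)\<close>, \<open>u(l) = A\<close>,
  \<open>u(r) = B\<close>, for \<open>u \<in> W\<^sup>2\<^sup>,\<^sup>\<infinity>(l,r)\<close>.  Here \<open>u\<close> is the representative that is continuous on
  \<open>[l,r]\<close>, so that the boundary values are meaningful; it is then continuously
  differentiable on \<open>(l,r)\<close>, and \<open>deriv u\<close> has one-sided limits at \<open>l\<close> and \<open>r\<close>.\<close>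

definition solves_bvp ::
  "real \<Rightarrow> real \<Rightarrow> real \<Rightarrow> real \<Rightarrow> real \<Rightarrow> (real \<Rightarrow> real) \<Rightarrow> real \<Rightarrow> real \<Rightarrow> (real \<Rightarrow> real) \<Rightarrow> bool" where
  "solves_bvp \<epsilon> b c l r g A B u \<longleftrightarrow>
     continuous_on {l..r} u \<and> u l = A \<and> u r = B \<and>
     (\<exists>v w. W2inf l r u v w \<and>
        (AE x in lebesgue_on {l<..<r}. - \<epsilon> * w x - b * v x + c * u x = g x))"

end

theory Submission
  imports Defs "HOL-Computational_Algebra.Polynomial"
begin

text \<open>Everything rests on the comparison principle: a supersolution that dominates the boundary
  data dominates the solution. For \<open>W\<^sup>2\<^sup>,\<^sup>\<infinity>\<close> solutions it follows from the classical argument at an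
  interior maximum, applied to a mollification of the solution; the equation has constant
  coefficients, so mollification preserves one-sided bounds on the left-hand side exactly.

  By linearity let \<open>\<alpha> \<ge> 0\<close>, and write \<open>F = \<parallel>f\<parallel>\<close>. Then \<open>-F(1 - x)/b \<le> u\<^sub>1 \<le> \<alpha> + F(1 - x)/b\<close>; the upper
  bound is attained at \<open>1\<close>, so \<open>u\<^sub>1'(1) \<ge> -F/b\<close>. As \<open>d \<ge> 0\<close>, the lower bound controls the delayed
  term from above, and if \<open>\<alpha> + \<delta>\<close> exceeds a suitable \<open>N\<close> of the order of the data, then
  \<open>u\<^sub>2 \<le> N + (\<alpha> + \<delta> - N) exp (-b(x - 1)/\<epsilon>)\<close> with equality at \<open>1\<close>, so
  \<open>u\<^sub>2'(1) \<le> -(b/\<epsilon>)(\<alpha> + \<delta> - N)\<close>. Equality of the two derivatives bounds \<open>\<alpha>\<close>.\<close>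

section \<open>Smooth mollifiers\<close>

text \<open>This is the regularity clause of \<open>test_function\<close>, so the kernels built
  below can serve as test functions.\<close>

definition smooth :: "(real \<Rightarrow> real) \<Rightarrow> bool" where
  "smooth f \<longleftrightarrow> (\<forall>k x. (deriv ^^ k) f differentiable (at x))"

text \<open>A finite-order form of smoothness: each differentiation lowers the order by one, so
  closure properties follow by induction on \<open>n\<close>.\<close>

definition diff_upto :: "nat \<Rightarrow> (real \<Rightarrow> real) \<Rightarrow> bool" where
  "diff_upto n f \<longleftrightarrow> (\<forall>k<n. \<forall>x. (deriv ^^ k) f differentiable (at x))"

lemma smooth_iff_diff_upto: "smooth f \<longleftrightarrow> (\<forall>n. diff_upto n f)"
  unfolding smooth_def diff_upto_def by blast

lemma diff_upto_0 [simp]: "diff_upto 0 f"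
  by (simp add: diff_upto_def)

lemma diff_upto_Suc:
  "diff_upto (Suc n) f \<longleftrightarrow> (\<forall>x. f differentiable (at x)) \<and> diff_upto n (deriv f)"
proof -
  have *: "(deriv ^^ Suc k) f = (deriv ^^ k) (deriv f)" for k
    by (simp only: funpow_Suc_right o_apply)
  have "diff_upto (Suc n) f \<longleftrightarrow>
      (\<forall>x. (deriv ^^ 0) f differentiable (at x)) \<and> (\<forall>k<n. \<forall>x. (deriv ^^ Suc k) f differentiable (at x))"
    unfolding diff_upto_def by (metis less_Suc_eq_0_disj)
  then show ?thesis
    unfolding * by (simp add: diff_upto_def)
qed

lemma diff_upto_SucD: "diff_upto (Suc n) f \<Longrightarrow> diff_upto n f"
  by (simp add: diff_upto_def)

lemma has_deriv_if_differentiable: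
  fixes f :: "real \<Rightarrow> real"
  assumes "f differentiable (at x)"
  shows "(f has_real_derivative deriv f x) (at x)"
  using assms DERIV_deriv_iff_real_differentiable by blast

lemma diff_upto_add: "diff_upto n f \<Longrightarrow> diff_upto n g \<Longrightarrow> diff_upto n (\<lambda>x. f x + g x)"
proof (induction n arbitrary: f g)
  case (Suc n)
  then have d: "\<And>x. f differentiable (at x)" "\<And>x. g differentiable (at x)"
    by (auto simp: diff_upto_Suc)
  have "deriv (\<lambda>x. f x + g x) = (\<lambda>x. deriv f x + deriv g x)"
    by (rule ext, rule DERIV_imp_deriv)
      (intro DERIV_add has_deriv_if_differentiable d)
  then show ?case
    using Suc d by (auto simp: diff_upto_Suc)
qed simp

text \<open>The product rule gives two products whose factors still have \<open>n\<close>
  derivatives, so the induction ranges over both factors.\<close>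

lemma diff_upto_mult: "diff_upto n f \<Longrightarrow> diff_upto n g \<Longrightarrow> diff_upto n (\<lambda>x. f x * g x)"
proof (induction n arbitrary: f g)
  case (Suc n)
  then have d: "\<And>x. f differentiable (at x)" "\<And>x. g differentiable (at x)"
    by (auto simp: diff_upto_Suc)
  have "deriv (\<lambda>x. f x * g x) = (\<lambda>x. deriv f x * g x + deriv g x * f x)"
    by (rule ext, rule DERIV_imp_deriv)
      (intro DERIV_mult has_deriv_if_differentiable d)
  moreover have "diff_upto n (\<lambda>x. deriv f x * g x + deriv g x * f x)"
    using Suc.prems[THEN diff_upto_SucD] Suc.prems
    by (intro diff_upto_add Suc.IH) (simp_all add: diff_upto_Suc)
  ultimately show ?case
    using d by (auto simp: diff_upto_Suc)
qed simp

text \<open>The constant \<open>c\<close> is generalised because every derivative contributes a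
  further factor \<open>p\<close>.\<close>

lemma diff_upto_affine:
  "diff_upto n f \<Longrightarrow> diff_upto n (\<lambda>x. c * f (p * x + q))"
proof (induction n arbitrary: f c)
  case (Suc n)
  then have d: "\<And>x. f differentiable (at x)"
    by (auto simp: diff_upto_Suc)
  have D: "((\<lambda>x. c * f (p * x + q)) has_real_derivative (c * p) * deriv f (p * x + q)) (at x)" for x
    by (rule derivative_eq_intros DERIV_chain2[OF has_deriv_if_differentiable[OF d]] refl)+ simp
  then have "deriv (\<lambda>x. c * f (p * x + q)) = (\<lambda>x. (c * p) * deriv f (p * x + q))"
    by (intro ext DERIV_imp_deriv)
  moreover have "(\<lambda>x. c * f (p * x + q)) differentiable (at x)" for x
    using D real_differentiable_def by blast
  ultimately show ?case
    using Suc by (auto simp: diff_upto_Suc)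
qed simp

lemma smooth_mult: "smooth f \<Longrightarrow> smooth g \<Longrightarrow> smooth (\<lambda>x. f x * g x)"
  by (simp add: smooth_iff_diff_upto diff_upto_mult)

lemma smooth_affine: "smooth f \<Longrightarrow> smooth (\<lambda>x. c * f (p * x + q))"
  by (simp add: smooth_iff_diff_upto diff_upto_affine)

lemma smooth_deriv: "smooth f \<Longrightarrow> smooth (deriv f)"
  unfolding smooth_iff_diff_upto using diff_upto_Suc by blast

lemma smooth_has_deriv: "smooth f \<Longrightarrow> (f has_real_derivative deriv f x) (at x)"
  unfolding smooth_iff_diff_upto using diff_upto_Suc has_deriv_if_differentiable by blast

lemma smooth_continuous_on: "smooth f \<Longrightarrow> continuous_on S f"
  using smooth_has_deriv DERIV_isCont continuous_at_imp_continuous_on by blast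

section \<open>Flat functions and compactly supported bump kernels\<close>

lemma poly_times_exp_neg_tendsto_0:
  fixes p :: "real poly"
  shows "((\<lambda>x. poly p x * exp (- x)) \<longlongrightarrow> 0) at_top"
proof -
  \<comment> \<open>The power \<open>x ^ k\<close> strengthens the induction: the factor
    \<open>x\<close> in \<open>pCons a p\<close> is absorbed by raising \<open>k\<close>.\<close>
  have "((\<lambda>x. x ^ k * poly p x * exp (- x)) \<longlongrightarrow> 0) at_top" for k
  proof (induction p arbitrary: k)
    case (pCons a p)
    have "((\<lambda>x. a * (x ^ k / exp x) + x ^ Suc k * poly p x * exp (- x)) \<longlongrightarrow> a * 0 + 0) at_top"
      by (intro tendsto_add tendsto_mult tendsto_const tendsto_power_div_exp_0 pCons)
    then show ?case
      by (simp add: exp_minus field_simps)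
  qed simp
  from this[of 0] show ?thesis
    by simp
qed

text \<open>The classical flat function exp(-1/x), extended by 0, with a polynomial in 1/x as a
  factor; the polynomial makes the family closed under differentiation.\<close>

definition flat :: "real poly \<Rightarrow> real \<Rightarrow> real" where
  "flat p x = (if x > 0 then poly p (1 / x) * exp (- (1 / x)) else 0)"

text \<open>With t = 1/x one has d/dx = -t^2 d/dt, and differentiating
  \<open>poly p t * exp (- t)\<close> gives the factor t^2 (p - p'); here \<open>[:0, 0, 1:]\<close>
  is t^2.\<close>

lemma flat_has_deriv:
  "(flat p has_real_derivative flat ([:0, 0, 1:] * (p - pderiv p)) x) (at x)"
proof -
  consider "x > 0" | "x < 0" | "x = 0"
    by linarith
  then show ?thesis
  proof cases
    case 1
    have "((\<lambda>x. poly p (1 / x) * exp (- (1 / x))) has_real_derivative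
            flat ([:0, 0, 1:] * (p - pderiv p)) x) (at x)"
      using 1 by (auto intro!: derivative_eq_intros DERIV_chain2[OF poly_DERIV]
          simp: flat_def field_simps power2_eq_square)
    then show ?thesis
      by (rule has_field_derivative_transform_within_open[of _ _ _ "{0<..}"])
        (use 1 in \<open>auto simp: flat_def\<close>)
  next
    case 2
    have "((\<lambda>x. 0) has_real_derivative flat ([:0, 0, 1:] * (p - pderiv p)) x) (at x)"
      using 2 by (simp add: flat_def)
    then show ?thesis
      by (rule has_field_derivative_transform_within_open[of _ _ _ "{..<0}"])
        (use 2 in \<open>auto simp: flat_def\<close>)
  next
    case 3
    \<comment> \<open>For y > 0 the difference quotient at 0 is the flat expression multiplied by
      1/y, and \<open>pCons 0 p\<close> encodes this extra factor.\<close>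
    have "((\<lambda>y. poly (pCons 0 p) (inverse y) * exp (- inverse y)) \<longlongrightarrow> 0) (at_right 0)"
      by (rule filterlim_compose[OF poly_times_exp_neg_tendsto_0 filterlim_inverse_at_top_right])
    then have "((\<lambda>y. (flat p y - flat p 0) / (y - 0)) \<longlongrightarrow> 0) (at_right 0)"
      by (rule Lim_transform_eventually)
        (auto simp: eventually_at_filter flat_def field_simps)
    moreover have "((\<lambda>y. (flat p y - flat p 0) / (y - 0)) \<longlongrightarrow> 0) (at_left 0)"
      by (rule Lim_transform_eventually[OF tendsto_const])
        (auto simp: eventually_at_filter flat_def)
    ultimately have "((\<lambda>y. (flat p y - flat p 0) / (y - 0)) \<longlongrightarrow> 0) (at 0)"
      using filterlim_split_at by blast
    then show ?thesis
      using 3 by (simp add: has_field_derivative_iff flat_def)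
  qed
qed

lemma smooth_flat: "smooth (flat p)"
proof -
  have "diff_upto n (flat p)" for n
  proof (induction n arbitrary: p)
    case (Suc n)
    have "deriv (flat p) = flat ([:0, 0, 1:] * (p - pderiv p))"
      using flat_has_deriv DERIV_imp_deriv by blast
    moreover have "flat p differentiable (at x)" for x
      using flat_has_deriv real_differentiable_def by blast
    ultimately show ?case
      using Suc by (simp add: diff_upto_Suc)
  qed simp
  then show ?thesis
    by (simp add: smooth_iff_diff_upto)
qed

text \<open>Nonnegativity and unit mass make convolution with \<open>k\<close> a weighted average,
  which is what preserves one-sided bounds.\<close>

definition mollifier :: "real \<Rightarrow> (real \<Rightarrow> real) \<Rightarrow> bool" where
  "mollifier h k \<longleftrightarrow> smooth k \<and> (\<forall>x. 0 \<le> k x) \<and> (\<forall>x. \<bar>x\<bar> \<ge> h \<longrightarrow> k x = 0) \<and>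
     (k has_integral 1) {-h..h}"

lemma mollifier_exists:
  assumes "h > 0"
  obtains k where "mollifier h k"
proof -
  \<comment> \<open>On (-h, h) this is exp(-1/(h+x)) exp(-1/(h-x)); outside, one of the two factors
    is 0. The explicit coefficients match \<open>smooth_affine\<close>.\<close>
  define g where "g x = flat 1 (1 * x + h) * flat 1 ((-1) * x + h)" for x
  have "smooth (\<lambda>x. (1 * flat 1 (1 * x + h)) * (1 * flat 1 ((-1) * x + h)))"
    by (intro smooth_mult smooth_affine smooth_flat)
  then have g: "smooth g"
    unfolding g_def by simp
  have nn: "0 \<le> g x" for x
    by (simp add: g_def flat_def)
  have z: "g x = 0" if "\<bar>x\<bar> \<ge> h" for x
    using that by (auto simp: g_def flat_def)
  define I where "I = integral {-h..h} g"
  have gI: "(g has_integral I) {-h..h}"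
    unfolding I_def
    by (intro integrable_integral integrable_continuous_real smooth_continuous_on g)
  \<comment> \<open>A continuous nonnegative function with integral 0 vanishes identically, whereas
    \<open>g 0 > 0\<close>.\<close>
  have "I \<noteq> 0"
  proof
    assume "I = 0"
    then have "g 0 = 0"
      using gI nn assms has_integral_0_cbox_imp_0[of "-h" h g 0] smooth_continuous_on[OF g]
      by auto
    then show False
      using assms by (simp add: g_def flat_def)
  qed
  moreover have "I \<ge> 0"
    using has_integral_nonneg[OF gI] nn by blast
  ultimately have "I > 0"
    by simp
  define k where "k x = 1 / I * g (1 * x + 0)" for x
  have "smooth k"
    unfolding k_def by (rule smooth_affine[OF g])
  moreover have "(k has_integral 1) {-h..h}"
    using has_integral_mult_right[OF gI, of "1/I"] \<open>I > 0\<close> by (simp add: k_def[abs_def])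
  ultimately have "mollifier h k"
    using nn z \<open>I > 0\<close> by (simp add: mollifier_def k_def)
  then show ?thesis
    by (rule that)
qed

section \<open>Mollification of Sobolev functions\<close>

lemma LinfD:
  assumes "f \<in> Linf l r"
  obtains M where "0 \<le> M" "f \<in> borel_measurable (lebesgue_on {l<..<r})"
    "AE x in lebesgue_on {l<..<r}. \<bar>f x\<bar> \<le> M"
proof -
  have m: "f \<in> borel_measurable (lebesgue_on {l<..<r})" and fin: "Linf_norm l r f < \<infinity>"
    using assms by (auto simp: Linf_def)
  have "AE x in lebesgue_on {l<..<r}. ereal \<bar>f x\<bar> \<le> Linf_norm l r f"
    unfolding Linf_norm_def by (rule esssup_AE)
  then have "AE x in lebesgue_on {l<..<r}. \<bar>f x\<bar> \<le> \<bar>real_of_ereal (Linf_norm l r f)\<bar>"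
    by eventually_elim (use fin in \<open>cases "Linf_norm l r f"; auto\<close>)
  then show ?thesis
    using that m by (metis abs_ge_zero)
qed

lemma integrable_Linf_mult:
  assumes "f \<in> Linf l r" "continuous_on UNIV g"
  shows "integrable (lebesgue_on {l<..<r}) (\<lambda>t. f t * g t :: real)"
proof -
  obtain M where M: "0 \<le> M" "f \<in> borel_measurable (lebesgue_on {l<..<r})"
    "AE x in lebesgue_on {l<..<r}. \<bar>f x\<bar> \<le> M"
    using LinfD[OF assms(1)] by blast
  have cg: "continuous_on S g" for S
    using assms(2) continuous_on_subset by blast
  obtain K where K: "\<And>x. x \<in> {l..r} \<Longrightarrow> \<bar>g x\<bar> \<le> K"
    using compact_imp_bounded[OF compact_continuous_image[OF cg compact_Icc[of l r]]]
    unfolding bounded_iff by fastforce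
  interpret finite_measure "lebesgue_on {l<..<r}"
    by (rule finite_measure_lebesgue_on) simp
  have [measurable]: "g \<in> borel_measurable (lebesgue_on {l<..<r})"
    by (rule continuous_imp_measurable_on_sets_lebesgue[OF cg]) simp
  show ?thesis
  proof (rule integrable_const_bound[where B = "M * K"])
    show "AE t in lebesgue_on {l<..<r}. norm (f t * g t) \<le> M * K"
      using M(3) AE_space
    proof eventually_elim
      case (elim t)
      then have "t \<in> {l..r}" by auto
      from mult_mono[OF elim(1) K[OF this]] M(1) show ?case
        by (simp add: abs_mult)
    qed
    show "(\<lambda>t. f t * g t) \<in> borel_measurable (lebesgue_on {l<..<r})"
      using M(2) by measurable
  qed
qed

section \<open>Convolution with a smooth kernel\<close>

lemma smooth_reflect: "smooth \<eta> \<Longrightarrow> smooth (\<lambda>t. \<eta> (x - t))"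
  using smooth_affine[of \<eta> 1 "-1" x] by (simp add: algebra_simps)

lemma deriv_smooth_reflect:
  assumes "smooth \<eta>"
  shows "deriv (\<lambda>t. \<eta> (x - t)) = (\<lambda>t. - deriv \<eta> (x - t))"
proof (intro ext DERIV_imp_deriv)
  fix t
  have "((\<lambda>t. x - t) has_real_derivative - 1) (at t)"
    by (auto intro!: derivative_eq_intros)
  from DERIV_chain2[OF smooth_has_deriv[OF assms] this]
  show "((\<lambda>t. \<eta> (x - t)) has_real_derivative - deriv \<eta> (x - t)) (at t)"
    by simp
qed

text \<open>These are the functions to be inserted into \<open>weak_deriv\<close>; the last two
  hypotheses keep the window [x-h, x+h] inside (l, r).\<close>

lemma test_function_reflect:
  assumes "smooth \<eta>" "\<And>s. \<bar>s\<bar> > h \<Longrightarrow> \<eta> s = 0" "l < x - h" "x + h < r"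
  shows "test_function l r (\<lambda>t. \<eta> (x - t))"
  unfolding test_function_def
proof (intro conjI exI[of _ "{x - h..x + h}"])
  show "\<forall>k s. (deriv ^^ k) (\<lambda>t. \<eta> (x - t)) differentiable (at s)"
    using smooth_reflect[OF assms(1)] by (simp add: smooth_def)
qed (use assms in auto)

text \<open>The minus sign from reflecting the kernel cancels the one from integration by
  parts.\<close>

lemma weak_deriv_convolution:
  assumes "weak_deriv l r p q" "smooth \<eta>" "\<And>s. \<bar>s\<bar> > h \<Longrightarrow> \<eta> s = 0" "l < x - h" "x + h < r"
  shows "(LINT t|lebesgue_on {l<..<r}. p t * deriv \<eta> (x - t)) =
         (LINT t|lebesgue_on {l<..<r}. q t * \<eta> (x - t))"
proof -
  have "(LINT t|lebesgue_on {l<..<r}. p t * deriv (\<lambda>t. \<eta> (x - t)) t) =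
      - (LINT t|lebesgue_on {l<..<r}. q t * \<eta> (x - t))"
    using assms(1) test_function_reflect[OF assms(2-5)] unfolding weak_deriv_def by blast
  then show ?thesis
    by (simp add: deriv_smooth_reflect[OF assms(2)])
qed

text \<open>The strict inequality describes an open set, on which the kernel is locally constant 0.
  This allows \<open>weak_deriv_convolution\<close> to be applied to the derivative of a
  kernel.\<close>

lemma deriv_eq_0_outside:
  assumes "\<And>s. \<bar>s\<bar> \<ge> h \<Longrightarrow> \<eta> s = 0" "\<bar>s\<bar> > h"
  shows "deriv \<eta> s = (0::real)"
proof (rule DERIV_imp_deriv)
  have "((\<lambda>_. 0) has_real_derivative 0) (at s)"
    by simp
  then show "(\<eta> has_real_derivative 0) (at s)"
  proof (rule has_field_derivative_transform_within_open[of _ _ _ "{..<-h} \<union> {h<..}"])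
    show "s \<in> {..<-h} \<union> {h<..}"
      using assms(2) by auto
  qed (use assms(1) in auto)
qed

lemma continuous_imp_integrable_open:
  fixes f :: "real \<Rightarrow> real"
  assumes "continuous_on {l..r} f"
  shows "integrable (lebesgue_on {l<..<r}) f"
proof (rule absolutely_integrable_imp_integrable)
  show "f absolutely_integrable_on {l<..<r}"
    by (rule set_integrable_subset[OF absolutely_integrable_continuous_real[OF assms]]) auto
qed simp

lemma integral_mollifier:
  assumes "mollifier h k" "l < x - h" "x + h < r"
  shows "(LINT t|lebesgue_on {l<..<r}. k (x - t)) = 1"
    and "integrable (lebesgue_on {l<..<r}) (\<lambda>t. k (x - t))"
proof -
  have k: "smooth k" "\<And>s. \<bar>s\<bar> \<ge> h \<Longrightarrow> k s = 0" "(k has_integral 1) (cbox (-h) h)"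
    using assms(1) by (auto simp: mollifier_def)
  have c: "continuous_on S (\<lambda>t. k (x - t))" for S
    by (intro smooth_continuous_on smooth_reflect k)
  have "((\<lambda>t. k (x - t)) has_integral 1) {x - h..x + h}"
    using has_integral_affinity[OF k(3), of "-1" x]
    by (simp add: algebra_simps image_diff_atLeastAtMost[unfolded minus_real_def])
  then have "((\<lambda>t. k (x - t)) has_integral 1) {l..r}"
  proof (rule has_integral_on_superset)
    show "k (x - t) = 0" if "t \<notin> {x - h..x + h}" for t
      using that by (intro k) auto
  qed (use assms in auto)
  then have "integral {l<..<r} (\<lambda>t. k (x - t)) = 1"
    using integral_open_interval_real[of l r "\<lambda>t. k (x - t)"] by (simp add: integral_unique)
  moreover show i: "integrable (lebesgue_on {l<..<r}) (\<lambda>t. k (x - t))"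
    by (intro continuous_imp_integrable_open c)
  ultimately show "(LINT t|lebesgue_on {l<..<r}. k (x - t)) = 1"
    using lebesgue_integral_eq_integral[OF i] by simp
qed

text \<open>Differentiation under the integral sign falls on the kernel only, so continuity of
  \<open>u\<close> suffices, at every real \<open>x\<close>.\<close>

lemma convolution_has_deriv:
  assumes u: "continuous_on {l..r} u" and \<eta>: "smooth \<eta>"
  shows "((\<lambda>x. integral {l..r} (\<lambda>t. u t * \<eta> (x - t))) has_real_derivative
     integral {l..r} (\<lambda>t. u t * deriv \<eta> (x - t))) (at x)"
proof -
  have "((\<lambda>x. integral (cbox l r) (\<lambda>t. u t * \<eta> (x - t))) has_real_derivative
     integral (cbox l r) (\<lambda>t. u t * deriv \<eta> (x - t))) (at x within UNIV)"
  proof (rule leibniz_rule_field_derivative)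
    show "((\<lambda>x. u t * \<eta> (x - t)) has_real_derivative u t * deriv \<eta> (x - t)) (at x)" for x t
      by (rule derivative_eq_intros DERIV_chain2[OF smooth_has_deriv[OF \<eta>]] refl)+ simp
    show "(\<lambda>t. u t * \<eta> (x - t)) integrable_on cbox l r" for x
      using u by (intro integrable_continuous continuous_on_mult
          smooth_continuous_on[OF smooth_reflect[OF \<eta>]]) simp
    have "continuous_on (UNIV \<times> cbox l r) (\<lambda>z. u (snd z))"
      using u by (intro continuous_on_compose2[OF u] continuous_intros) auto
    moreover have "continuous_on (UNIV \<times> cbox l r) (\<lambda>z. deriv \<eta> (fst z - snd z))"
      by (intro continuous_on_compose2[OF smooth_continuous_on[of _ UNIV, OF smooth_deriv[OF \<eta>]]]
          continuous_intros) auto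
    ultimately show "continuous_on (UNIV \<times> cbox l r) (\<lambda>(x, t). u t * deriv \<eta> (x - t))"
      unfolding case_prod_unfold by (rule continuous_on_mult)
  qed auto
  then show ?thesis by simp
qed

text \<open>Connects the gauge integral of the Leibniz rule with the Lebesgue integral of
  \<open>weak_deriv\<close>; the end points form a null set.\<close>

lemma convolution_eq_Lebesgue:
  assumes u: "continuous_on {l..r} u" and \<eta>: "smooth \<eta>"
  shows "integral {l..r} (\<lambda>t. u t * \<eta> (x - t)) = (LINT t|lebesgue_on {l<..<r}. u t * \<eta> (x - t))"
proof -
  have "integrable (lebesgue_on {l<..<r}) (\<lambda>t. u t * \<eta> (x - t))"
    by (intro continuous_imp_integrable_open continuous_on_mult u)
      (intro smooth_continuous_on smooth_reflect \<eta>)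
  from lebesgue_integral_eq_integral[OF this] show ?thesis
    using integral_open_interval_real[of l r "\<lambda>t. u t * \<eta> (x - t)"] by simp
qed

text \<open>In the last conclusion \<open>p\<close>, \<open>q\<close>, \<open>s\<close> and \<open>G\<close> are arbitrary, so it yields both the equation's
  one-sided bound for the approximation and, with two of \<open>p\<close>, \<open>q\<close>, \<open>s\<close> zero, uniform bounds on
  its derivatives.\<close>

lemma W2inf_approx:
  assumes u: "continuous_on {l..r} u" and W: "W2inf l r u v w"
    and lab: "l < a" "b < r" and e: "e > 0"
  obtains U U' U'' where
    "\<And>x. (U has_real_derivative U' x) (at x)"
    "\<And>x. (U' has_real_derivative U'' x) (at x)"
    "\<And>x. x \<in> {a..b} \<Longrightarrow> \<bar>U x - u x\<bar> \<le> e"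
    "\<And>p q s G x. AE t in lebesgue_on {l<..<r}. p * w t + q * v t + s * u t \<le> G \<Longrightarrow> x \<in> {a..b} \<Longrightarrow>
       p * U'' x + q * U' x + s * U x \<le> G"
proof -
  let ?M = "lebesgue_on {l<..<r}"
  have "uniformly_continuous_on {l..r} u"
    by (rule compact_uniformly_continuous[OF u]) simp
  then obtain d where d: "d > 0" "\<And>s t. s \<in> {l..r} \<Longrightarrow> t \<in> {l..r} \<Longrightarrow> \<bar>s - t\<bar> < d \<Longrightarrow> \<bar>u s - u t\<bar> < e"
    using e unfolding uniformly_continuous_on_def dist_real_def by (metis abs_minus_commute)
  \<comment> \<open>The radius is below \<open>d\<close> for uniform closeness of \<open>U\<close>
    and \<open>u\<close>, and below the distances from [a, b] to the end points, so that every
    window lies in (l, r).\<close>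
  define h where "h = min d (min (a - l) (r - b)) / 2"
  have h: "h > 0" "h < d" "h < a - l" "h < r - b"
    using d(1) lab by (auto simp: h_def min_def)
  obtain k where k: "mollifier h k"
    using mollifier_exists[OF h(1)] .
  then have k': "smooth k" "\<And>s. 0 \<le> k s" "\<And>s. \<bar>s\<bar> \<ge> h \<Longrightarrow> k s = 0"
    by (auto simp: mollifier_def)
  have wd: "weak_deriv l r u v" "weak_deriv l r v w"
    and Li: "u \<in> Linf l r" "v \<in> Linf l r" "w \<in> Linf l r"
    using W by (auto simp: W2inf_def)
  define U where "U x = integral {l..r} (\<lambda>t. u t * k (x - t))" for x
  define U' where "U' x = integral {l..r} (\<lambda>t. u t * deriv k (x - t))" for x
  define U'' where "U'' x = integral {l..r} (\<lambda>t. u t * deriv (deriv k) (x - t))" for x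
  have kc: "continuous_on UNIV (\<lambda>t. k (x - t))" for x
    by (intro smooth_continuous_on smooth_reflect k')
  have U: "U x = (LINT t|?M. u t * k (x - t))" for x
    unfolding U_def by (rule convolution_eq_Lebesgue[OF u k'(1)])
  have U': "U' x = (LINT t|?M. v t * k (x - t))" if "x \<in> {a..b}" for x
    unfolding U'_def convolution_eq_Lebesgue[OF u smooth_deriv[OF k'(1)]]
    by (rule weak_deriv_convolution[OF wd(1) k'(1), where h = h]) (use k' h that in auto)
  \<comment> \<open>One derivative of the kernel is moved onto \<open>u\<close>, giving
    \<open>v\<close>, and the other onto \<open>v\<close>, giving \<open>w\<close>.\<close>
  have U'': "U'' x = (LINT t|?M. w t * k (x - t))" if "x \<in> {a..b}" for x
  proof -
    have "U'' x = (LINT t|?M. v t * deriv k (x - t))"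
      unfolding U''_def convolution_eq_Lebesgue[OF u smooth_deriv[OF smooth_deriv[OF k'(1)]]]
      by (rule weak_deriv_convolution[OF wd(1) smooth_deriv[OF k'(1)] deriv_eq_0_outside, of h])
        (use k' h that in auto)
    also have "\<dots> = (LINT t|?M. w t * k (x - t))"
      by (rule weak_deriv_convolution[OF wd(2) k'(1), where h = h]) (use k' h that in auto)
    finally show ?thesis .
  qed
  note I = integrable_Linf_mult[OF Li(1) kc] integrable_Linf_mult[OF Li(2) kc] integrable_Linf_mult[OF Li(3) kc]
  have mI: "(LINT t|?M. k (x - t)) = 1" "integrable ?M (\<lambda>t. k (x - t))" if "x \<in> {a..b}" for x
    using integral_mollifier[OF k, of l x r] h that by auto
  have av: "p * U'' x + q * U' x + s * U x \<le> G"
    if G: "AE t in ?M. p * w t + q * v t + s * u t \<le> G" and x: "x \<in> {a..b}" for p q s G x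
  proof -
    have "p * U'' x + q * U' x + s * U x =
        (LINT t|?M. p * (w t * k (x - t)) + q * (v t * k (x - t)) + s * (u t * k (x - t)))"
      using I by (simp add: U U'[OF x] U''[OF x])
    \<comment> \<open>The almost-everywhere bound is integrated against the nonnegative kernel; unit
      mass then returns \<open>G\<close> itself.\<close>
    also have "\<dots> \<le> (LINT t|?M. G * k (x - t))"
    proof (rule integral_mono_AE)
      show "AE t in ?M. p * (w t * k (x - t)) + q * (v t * k (x - t)) + s * (u t * k (x - t)) \<le> G * k (x - t)"
        using G
      proof eventually_elim
        case (elim t)
        show ?case
          using mult_right_mono[OF elim k'(2)[of "x - t"]] by (simp add: algebra_simps)
      qed
    qed (use I mI x in auto)
    also have "\<dots> = G"
      using mI x by simp
    finally show ?thesis .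
  qed
  \<comment> \<open>Inside the window uniform continuity applies; outside it both sides are
    0.\<close>
  have near: "\<bar>u t * k (x - t) - u x * k (x - t)\<bar> \<le> e * k (x - t)"
    if x: "x \<in> {a..b}" and t: "t \<in> {l<..<r}" for x t
  proof (cases "\<bar>x - t\<bar> < h")
    case True
    then have "\<bar>t - x\<bar> < d"
      using h by (simp add: abs_minus_commute)
    then have "\<bar>u t - u x\<bar> \<le> e"
      using d(2)[of t x] x t lab by auto
    from mult_right_mono[OF this k'(2)[of "x - t"]] show ?thesis
      using k'(2)[of "x - t"] by (simp add: abs_mult flip: left_diff_distrib)
  qed (simp add: k')
  have "\<bar>U x - u x\<bar> \<le> e" if x: "x \<in> {a..b}" for x
  proof -
    have "U x - u x = (LINT t|?M. u t * k (x - t) - u x * k (x - t))"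
      using I mI x by (simp add: U)
    also have "\<bar>\<dots>\<bar> \<le> (LINT t|?M. \<bar>u t * k (x - t) - u x * k (x - t)\<bar>)"
      by (rule integral_abs_bound)
    also have "\<dots> \<le> (LINT t|?M. e * k (x - t))"
      by (rule integral_mono) (use I mI x near in auto)
    also have "\<dots> = e"
      using mI x by simp
    finally show ?thesis .
  qed
  moreover have "(U has_real_derivative U' x) (at x)" "(U' has_real_derivative U'' x) (at x)" for x
    unfolding U_def[abs_def] U'_def[abs_def] U''_def
    by (intro convolution_has_deriv u smooth_deriv k')+
  ultimately show ?thesis
    using that av by blast
qed

section \<open>The comparison principle\<close>

text \<open>The derivatives at \<open>x\<close> of a sequence of mollifications are bounded, hence subconverge to some
  \<open>p\<close>; their second derivatives are bounded uniformly, so Taylor's estimate passes to the limit.\<close>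

lemma W2inf_differentiable:
  assumes u: "continuous_on {l..r} u" and W: "W2inf l r u v w" and x: "x \<in> {l<..<r}"
  shows "u differentiable (at x)"
proof -
  obtain V where V: "AE t in lebesgue_on {l<..<r}. \<bar>v t\<bar> \<le> V"
    using W LinfD unfolding W2inf_def by metis
  obtain D where D: "0 \<le> D" "AE t in lebesgue_on {l<..<r}. \<bar>w t\<bar> \<le> D"
    using W LinfD unfolding W2inf_def by metis
  obtain a b where ab: "l < a" "a < x" "x < b" "b < r"
    using x dense[of l x] dense[of x r] by auto
  have "\<exists>U U' U''. (\<forall>y. (U has_real_derivative U' y) (at y)) \<and> (\<forall>y. (U' has_real_derivative U'' y) (at y)) \<and>
      (\<forall>y\<in>{a..b}. \<bar>U y - u y\<bar> \<le> inverse (real (Suc n)) \<and> \<bar>U' y\<bar> \<le> V \<and> \<bar>U'' y\<bar> \<le> D)" for n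
  proof -
    obtain U U' U'' where U:
      "\<And>x. (U has_real_derivative U' x) (at x)"
      "\<And>x. (U' has_real_derivative U'' x) (at x)"
      "\<And>x. x \<in> {a..b} \<Longrightarrow> \<bar>U x - u x\<bar> \<le> inverse (real (Suc n))"
      and av: "\<And>p q s G x. AE t in lebesgue_on {l<..<r}. p * w t + q * v t + s * u t \<le> G \<Longrightarrow> x \<in> {a..b} \<Longrightarrow>
         p * U'' x + q * U' x + s * U x \<le> G"
      using W2inf_approx[OF u W ab(1,4), of "inverse (real (Suc n))"] by auto
    have "\<bar>U' y\<bar> \<le> V \<and> \<bar>U'' y\<bar> \<le> D" if "y \<in> {a..b}" for y
      using av[of 0 1 0 V y] av[of 0 "-1" 0 V y] av[of 1 0 0 D y] av[of "-1" 0 0 D y] V D(2) that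
      by (auto simp: abs_le_iff)
    then show ?thesis
      using U by blast
  qed
  then obtain U U' U'' where U:
    "\<And>n y. (U n has_real_derivative U' n y) (at y)"
    "\<And>n y. (U' n has_real_derivative U'' n y) (at y)"
    "\<And>n y. y \<in> {a..b} \<Longrightarrow> \<bar>U n y - u y\<bar> \<le> inverse (real (Suc n)) \<and> \<bar>U' n y\<bar> \<le> V \<and> \<bar>U'' n y\<bar> \<le> D"
    by metis
  have "bounded (range (\<lambda>n. U' n x))"
    using U(3)[of x] ab by (auto simp: bounded_iff)
  then obtain p \<phi> where \<phi>: "strict_mono \<phi>" and p: "(\<lambda>n. U' (\<phi> n) x) \<longlonglongrightarrow> p"
    using bounded_imp_convergent_subsequence[of "\<lambda>n. U' n x"] by (auto simp: o_def)
  have lim: "(\<lambda>n. U (\<phi> n) y) \<longlonglongrightarrow> u y" if "y \<in> {a..b}" for y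
  proof -
    have "(\<lambda>n. U n y - u y) \<longlonglongrightarrow> 0"
      by (rule Lim_null_comparison[OF _ LIMSEQ_inverse_real_of_nat]) (use U(3) that in auto)
    then have "(\<lambda>n. U n y) \<longlonglongrightarrow> u y"
      by (rule LIM_zero_cancel)
    from LIMSEQ_subseq_LIMSEQ[OF this \<phi>] show ?thesis
      by (simp add: o_def)
  qed
  \<comment> \<open>The mean value inequality is used twice: \<open>U' n\<close> varies by at most
    D|y-x| between \<open>x\<close> and \<open>y\<close>, which bounds the derivative of t -> U(t) -
    U'(x) t there. The constant is uniform in \<open>n\<close>.\<close>
  have taylor: "\<bar>U n y - U n x - U' n x * (y - x)\<bar> \<le> D * \<bar>y - x\<bar> * \<bar>y - x\<bar>" if y: "y \<in> {a..b}" for n y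
  proof -
    have sub: "closed_segment x y \<subseteq> {a..b}"
      using y ab by (simp add: closed_segment_subset)
    have 1: "\<bar>U' n t - U' n x\<bar> \<le> D * \<bar>y - x\<bar>" if t: "t \<in> closed_segment x y" for t
    proof -
      have "norm (U' n t - U' n x) \<le> D * norm (t - x)"
        by (rule field_differentiable_bound[of "closed_segment x y" _ "U'' n"])
          (use U(2,3) sub t in \<open>auto intro: has_field_derivative_at_within\<close>)
      also have "\<dots> \<le> D * \<bar>y - x\<bar>"
        using t D(1) by (intro mult_left_mono) (auto simp: closed_segment_eq_real_ivl split: if_splits)
      finally show ?thesis by simp
    qed
    have "norm ((U n y - U' n x * y) - (U n x - U' n x * x)) \<le> D * \<bar>y - x\<bar> * norm (y - x)"
    proof (rule field_differentiable_bound[of "closed_segment x y" _ "\<lambda>t. U' n t - U' n x"])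
      show "((\<lambda>t. U n t - U' n x * t) has_real_derivative U' n t - U' n x) (at t within closed_segment x y)" for t
        by (rule has_field_derivative_at_within) (auto intro!: derivative_eq_intros U(1))
    qed (use 1 in auto)
    then show ?thesis
      by (simp add: algebra_simps)
  qed
  have est: "\<bar>u y - u x - p * (y - x)\<bar> \<le> D * \<bar>y - x\<bar> * \<bar>y - x\<bar>" if y: "y \<in> {a..b}" for y
  proof (rule tendsto_upperbound)
    show "(\<lambda>n. \<bar>U (\<phi> n) y - U (\<phi> n) x - U' (\<phi> n) x * (y - x)\<bar>) \<longlonglongrightarrow> \<bar>u y - u x - p * (y - x)\<bar>"
      using ab y by (intro tendsto_intros lim p) auto
  qed (use taylor y in auto)
  have "((\<lambda>y. (u y - u x) / (y - x) - p) \<longlongrightarrow> 0) (at x)"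
  proof (rule Lim_null_comparison)
    have "((\<lambda>y. D * \<bar>y - x\<bar>) \<longlongrightarrow> D * \<bar>x - x\<bar>) (at x)"
      by (intro tendsto_intros)
    then show "((\<lambda>y. D * \<bar>y - x\<bar>) \<longlongrightarrow> 0) (at x)"
      by simp
    have "\<forall>\<^sub>F y in at x. y \<in> {a<..<b}"
      using ab by (intro eventually_at_in_open') auto
    moreover have "\<forall>\<^sub>F y in at x. y \<noteq> x"
      by (simp add: eventually_at_filter)
    ultimately show "\<forall>\<^sub>F y in at x. norm ((u y - u x) / (y - x) - p) \<le> D * \<bar>y - x\<bar>"
    proof eventually_elim
      case (elim y)
      have "(u y - u x) / (y - x) - p = (u y - u x - p * (y - x)) / (y - x)"
        using elim by (simp add: field_simps)
      then show ?case
        using est[of y] elim by (simp add: divide_le_eq)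
    qed
  qed
  then have "(u has_real_derivative p) (at x)"
    by (simp add: has_field_derivative_iff LIM_zero_cancel)
  then show ?thesis
    using real_differentiable_def by blast
qed

text \<open>If \<open>D > 0\<close>, then \<open>f'\<close> is positive immediately to the right of
  \<open>y\<close>, so \<open>f\<close> increases there beyond its maximum.\<close>

lemma second_derivative_nonpos_at_max:
  fixes f :: "real \<Rightarrow> real"
  assumes f: "\<And>x. (f has_real_derivative f' x) (at x)" "(f' has_real_derivative D) (at y)"
    and y: "y \<in> {a<..<b}" and max: "\<And>x. x \<in> {a..b} \<Longrightarrow> f x \<le> f y"
  shows "f' y = 0" "D \<le> 0"
proof -
  show z: "f' y = 0"
  proof (rule DERIV_local_max[OF f(1)])
    show "0 < min (y - a) (b - y)"
      using y by auto
    show "\<forall>x. \<bar>y - x\<bar> < min (y - a) (b - y) \<longrightarrow> f x \<le> f y"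
      by (auto intro!: max)
  qed
  show "D \<le> 0"
  proof (rule ccontr)
    assume "\<not> D \<le> 0"
    then obtain d where d: "d > 0" "\<And>h. h > 0 \<Longrightarrow> h < d \<Longrightarrow> f' y < f' (y + h)"
      using DERIV_pos_inc_right[OF f(2)] by auto
    define x where "x = y + min (d / 2) (b - y)"
    have x: "y < x" "x \<le> b" "x < y + d"
      using d(1) y by (auto simp: x_def)
    obtain t where t: "y < t" "t < x" "f x - f y = (x - y) * f' t"
      using MVT2[OF x(1), of f f'] f(1) by blast
    have "f' t > 0"
      using d(2)[of "t - y"] t x z by simp
    then have "f x - f y > 0"
      unfolding t(3) using x(1) by (intro mult_pos_pos) auto
    then show False
      using max[of x] x y by auto
  qed
qed

text \<open>The right-hand side enters through a constant \<open>G\<close> because averaging leaves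
  constants unchanged, whereas a variable bound would itself be averaged.\<close>

lemma bvp_comparison:
  assumes eps: "\<epsilon> > 0" and c: "c > 0" and sol: "solves_bvp \<epsilon> b c l r g A B u"
    and g: "AE x in lebesgue_on {l<..<r}. g x \<le> G"
    and S: "\<And>x. (S has_real_derivative S' x) (at x)" "\<And>x. (S' has_real_derivative S'' x) (at x)"
    and super: "\<And>x. x \<in> {l<..<r} \<Longrightarrow> G \<le> - \<epsilon> * S'' x - b * S' x + c * S x"
    and bd: "A \<le> S l" "B \<le> S r" and x: "x \<in> {l..r}"
  shows "u x \<le> S x"
proof (rule ccontr)
  assume "\<not> u x \<le> S x"
  define z where "z t = u t - S t" for t
  define m where "m = z x"
  have m: "m > 0"
    using \<open>\<not> u x \<le> S x\<close> by (simp add: m_def z_def)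
  have u: "continuous_on {l..r} u" "u l = A" "u r = B"
    using sol by (auto simp: solves_bvp_def)
  obtain v w where W: "W2inf l r u v w"
    and eq: "AE t in lebesgue_on {l<..<r}. - \<epsilon> * w t - b * v t + c * u t = g t"
    using sol unfolding solves_bvp_def by blast
  have cS: "continuous_on T S" for T
    using S(1) DERIV_isCont continuous_at_imp_continuous_on by blast
  have cz: "continuous_on {l..r} z"
    unfolding z_def by (intro continuous_intros u cS)
  have zlr: "z l \<le> 0" "z r \<le> 0"
    using u bd by (auto simp: z_def)
  \<comment> \<open>Mollification is controlled only on compact subintervals, so the end points move
    in to where \<open>z\<close> equals m/3. With error m/4, \<open>Z\<close> is at most 7m/12 there
    but at least 3m/4 at \<open>x\<close>, which forces an interior maximum.\<close>
  obtain a' where a': "a' \<in> {l..x}" "z a' = m / 3"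
    using IVT'[of z l "m / 3" x] zlr m x continuous_on_subset[OF cz, of "{l..x}"]
    by (auto simp: m_def)
  obtain b' where b': "b' \<in> {x..r}" "z b' = m / 3"
    using IVT2'[of z r "m / 3" x] zlr m x continuous_on_subset[OF cz, of "{x..r}"]
    by (auto simp: m_def)
  have ne: "a' \<noteq> l" "a' \<noteq> x" "b' \<noteq> r" "b' \<noteq> x"
    using a' b' zlr m by (auto simp: m_def)
  have ab: "l < a'" "a' < x" "x < b'" "b' < r"
    using a'(1) b'(1) ne by auto
  obtain U U' U'' where U:
    "\<And>x. (U has_real_derivative U' x) (at x)"
    "\<And>x. (U' has_real_derivative U'' x) (at x)"
    "\<And>x. x \<in> {a'..b'} \<Longrightarrow> \<bar>U x - u x\<bar> \<le> m / 4"
    and av: "\<And>p q s G x. AE t in lebesgue_on {l<..<r}. p * w t + q * v t + s * u t \<le> G \<Longrightarrow> x \<in> {a'..b'} \<Longrightarrow>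
       p * U'' x + q * U' x + s * U x \<le> G"
    using W2inf_approx[OF u(1) W ab(1,4), of "m / 4"] m by auto
  define Z where "Z t = U t - S t" for t
  have cU: "continuous_on T U" for T
    using U(1) DERIV_isCont continuous_at_imp_continuous_on by blast
  have cZ: "continuous_on {a'..b'} Z"
    unfolding Z_def by (intro continuous_intros cU cS)
  obtain y where y: "y \<in> {a'..b'}" "\<And>t. t \<in> {a'..b'} \<Longrightarrow> Z t \<le> Z y"
    using continuous_attains_sup[OF _ _ cZ] ab by fastforce
  have Zz: "\<bar>Z t - z t\<bar> \<le> m / 4" if "t \<in> {a'..b'}" for t
    using U(3)[OF that] by (simp add: Z_def z_def)
  have Zy: "Z y \<ge> m - m / 4"
    using y(2)[of x] Zz[of x, folded m_def] ab unfolding abs_le_iff by simp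
  have "y \<noteq> a'" "y \<noteq> b'"
    using Zy Zz[of a'] Zz[of b'] a'(2) b'(2) ab m by (auto simp: abs_le_iff)
  then have yin: "y \<in> {a'<..<b'}"
    using y(1) by auto
  have ZD: "(Z has_real_derivative U' t - S' t) (at t)"
    "((\<lambda>t. U' t - S' t) has_real_derivative U'' t - S'' t) (at t)" for t
    unfolding Z_def[abs_def] by (intro DERIV_diff U S)+
  note crit = second_derivative_nonpos_at_max[of Z, OF ZD(1) ZD(2) yin y(2)]
  have "AE t in lebesgue_on {l<..<r}. (- \<epsilon>) * w t + (- b) * v t + c * u t \<le> G"
    using eq g by eventually_elim simp
  from av[OF this y(1)] have "- \<epsilon> * U'' y - b * U' y + c * U y \<le> G"
    by simp
  also have "G \<le> - \<epsilon> * S'' y - b * S' y + c * S y"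
    using super[of y] yin ab by auto
  \<comment> \<open>At the maximum the first-order difference vanishes and the second-order one is
    nonpositive, contradicting \<open>Z y > 0\<close>.\<close>
  finally have "c * Z y \<le> \<epsilon> * (U'' y - S'' y) + b * (U' y - S' y)"
    by (simp add: Z_def algebra_simps)
  also have "\<dots> \<le> 0"
    using crit eps by (simp add: mult_nonneg_nonpos)
  finally show False
    using Zy m mult_pos_pos[OF c, of "Z y"] by simp
qed

section \<open>Slopes at an end point where a barrier touches\<close>

text \<open>By l'Hopital, the limit of \<open>deriv u\<close> is also the limit of the difference
  quotients of \<open>u\<close> at \<open>a\<close>, which lie below those of \<open>S\<close> since
  the two functions agree at \<open>a\<close>.\<close>

lemma deriv_limit_at_right_le:
  assumes "a < b" and u: "continuous_on {a..b} u" "\<And>x. x \<in> {a<..<b} \<Longrightarrow> u differentiable (at x)"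
    and L: "(deriv u \<longlongrightarrow> L) (at_right a)"
    and S: "(S has_real_derivative D) (at a)" "\<And>x. x \<in> {a..b} \<Longrightarrow> u x \<le> S x" "u a = S a"
  shows "L \<le> (D::real)"
proof (rule tendsto_le[OF trivial_limit_at_right_real])
  have ev: "\<forall>\<^sub>F x in at_right a. x \<in> {a<..<b}"
    using \<open>a < b\<close> by (rule eventually_at_right_real)
  show "((\<lambda>x. (S x - S a) / (x - a)) \<longlongrightarrow> D) (at_right a)"
    using has_field_derivative_at_within[OF S(1)] by (simp add: has_field_derivative_iff)
  show "\<forall>\<^sub>F x in at_right a. (u x - u a) / (x - a) \<le> (S x - S a) / (x - a)"
    using ev by eventually_elim (use S in \<open>auto intro!: divide_right_mono\<close>)
  show "((\<lambda>x. (u x - u a) / (x - a)) \<longlongrightarrow> L) (at_right a)"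
  proof (rule lhopital_right[where f' = "deriv u" and g' = "\<lambda>_. 1"])
    have "(u \<longlongrightarrow> u a) (at_right a)"
      using u(1) \<open>a < b\<close> by (simp add: continuous_on_Icc_at_rightD)
    then show "((\<lambda>x. u x - u a) \<longlongrightarrow> 0) (at_right a)"
      by (rule LIM_zero)
    show "((\<lambda>x. x - a) \<longlongrightarrow> 0) (at_right a)"
      by (rule LIM_zero) (rule tendsto_ident_at)
    show "\<forall>\<^sub>F x in at_right a. ((\<lambda>x. u x - u a) has_real_derivative deriv u x) (at x)"
      using ev by eventually_elim
        (auto intro!: derivative_eq_intros has_deriv_if_differentiable u(2))
    show "\<forall>\<^sub>F x in at_right a. ((\<lambda>x. x - a) has_real_derivative 1) (at x)"
      by (auto intro!: always_eventually derivative_eq_intros)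
    show "\<forall>\<^sub>F x in at_right a. x - a \<noteq> 0"
      using ev by eventually_elim auto
  qed (use L in auto)
qed

text \<open>As at a left end point, but the denominators \<open>x - b\<close> are negative, so the
  inequality is reversed.\<close>

lemma deriv_limit_at_left_ge:
  assumes "a < b" and u: "continuous_on {a..b} u" "\<And>x. x \<in> {a<..<b} \<Longrightarrow> u differentiable (at x)"
    and L: "(deriv u \<longlongrightarrow> L) (at_left b)"
    and S: "(S has_real_derivative D) (at b)" "\<And>x. x \<in> {a..b} \<Longrightarrow> u x \<le> S x" "u b = S b"
  shows "(D::real) \<le> L"
proof (rule tendsto_le[OF trivial_limit_at_left_real])
  have ev: "\<forall>\<^sub>F x in at_left b. x \<in> {a<..<b}"
    using \<open>a < b\<close> by (rule eventually_at_left_real)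
  show "((\<lambda>x. (S x - S b) / (x - b)) \<longlongrightarrow> D) (at_left b)"
    using has_field_derivative_at_within[OF S(1)] by (simp add: has_field_derivative_iff)
  show "\<forall>\<^sub>F x in at_left b. (S x - S b) / (x - b) \<le> (u x - u b) / (x - b)"
    using ev by eventually_elim (use S in \<open>auto intro!: divide_right_mono_neg\<close>)
  show "((\<lambda>x. (u x - u b) / (x - b)) \<longlongrightarrow> L) (at_left b)"
  proof (rule lhopital_left[where f' = "deriv u" and g' = "\<lambda>_. 1"])
    have "(u \<longlongrightarrow> u b) (at_left b)"
      using u(1) \<open>a < b\<close> by (simp add: continuous_on_Icc_at_leftD)
    then show "((\<lambda>x. u x - u b) \<longlongrightarrow> 0) (at_left b)"
      by (rule LIM_zero)
    show "((\<lambda>x. x - b) \<longlongrightarrow> 0) (at_left b)"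
      by (rule LIM_zero) (rule tendsto_ident_at)
    show "\<forall>\<^sub>F x in at_left b. ((\<lambda>x. u x - u b) has_real_derivative deriv u x) (at x)"
      using ev by eventually_elim
        (auto intro!: derivative_eq_intros has_deriv_if_differentiable u(2))
    show "\<forall>\<^sub>F x in at_left b. ((\<lambda>x. x - b) has_real_derivative 1) (at x)"
      by (auto intro!: always_eventually derivative_eq_intros)
    show "\<forall>\<^sub>F x in at_left b. x - b \<noteq> 0"
      using ev by eventually_elim auto
  qed (use L in auto)
qed

section \<open>The coupled problem\<close>

lemma Linf_uminus:
  assumes "f \<in> Linf l r"
  shows "(\<lambda>x. - f x) \<in> Linf l r"
  using assms by (simp add: Linf_def Linf_norm_def)

lemma weak_deriv_uminus:
  assumes "weak_deriv l r u v"
  shows "weak_deriv l r (\<lambda>x. - u x) (\<lambda>x. - v x)"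
  using assms by (simp add: weak_deriv_def locally_integrable_def)

text \<open>Linearity under a change of sign turns every upper bound into a lower bound.\<close>

lemma solves_bvp_uminus:
  assumes "solves_bvp \<epsilon> b c l r g A B u"
  shows "solves_bvp \<epsilon> b c l r (\<lambda>x. - g x) (- A) (- B) (\<lambda>x. - u x)"
proof -
  obtain v w where W: "W2inf l r u v w"
    and eq: "AE t in lebesgue_on {l<..<r}. - \<epsilon> * w t - b * v t + c * u t = g t"
    using assms unfolding solves_bvp_def by blast
  have "W2inf l r (\<lambda>x. - u x) (\<lambda>x. - v x) (\<lambda>x. - w x)"
    using W by (simp add: W2inf_def Linf_uminus weak_deriv_uminus)
  moreover have "AE t in lebesgue_on {l<..<r}. - \<epsilon> * - w t - b * - v t + c * - u t = - g t"
    using eq by eventually_elim (simp add: algebra_simps)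
  moreover have "continuous_on {l..r} (\<lambda>x. - u x)" "- u l = - A" "- u r = - B"
    using assms by (auto simp: solves_bvp_def intro: continuous_on_minus)
  ultimately show ?thesis
    unfolding solves_bvp_def by blast
qed

lemma solves_bvp_differentiable:
  "solves_bvp \<epsilon> b c l r g A B u \<Longrightarrow> x \<in> {l<..<r} \<Longrightarrow> u differentiable (at x)"
  unfolding solves_bvp_def using W2inf_differentiable by blast

section \<open>Barriers independent of the perturbation parameter\<close>

text \<open>For a linear barrier of slope -F/b the diffusion term vanishes, the convection term
  equals \<open>F\<close>, and the reaction term is nonnegative.\<close>

lemma solves_bvp_le_linear:
  assumes "\<epsilon> > 0" "b > 0" "c > 0" "F \<ge> 0" "K \<ge> 0"
    and "solves_bvp \<epsilon> b c l r g A B u" "AE x in lebesgue_on {l<..<r}. g x \<le> F"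
    and "A \<le> K + F / b * (r - l)" "B \<le> K" "x \<in> {l..r}"
  shows "u x \<le> K + F / b * (r - x)"
proof (rule bvp_comparison[OF assms(1,3,6,7), where S = "\<lambda>x. K + F / b * (r - x)"
      and S' = "\<lambda>_. - (F / b)" and S'' = "\<lambda>_. 0"])
  show "((\<lambda>x. K + F / b * (r - x)) has_real_derivative - (F / b)) (at x)" for x
    using assms(2) by (auto intro!: derivative_eq_intros)
  show "F \<le> - \<epsilon> * 0 - b * - (F / b) + c * (K + F / b * (r - x))" if "x \<in> {l<..<r}" for x
  proof -
    have "0 \<le> c * (K + F / b * (r - x))"
      using assms that by (intro mult_nonneg_nonneg add_nonneg_nonneg) auto
    then show ?thesis
      using assms(2) by simp
  qed
qed (use assms in auto)

text \<open>For a constant barrier the reaction term alone absorbs the right-hand side.\<close>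

lemma solves_bvp_le_const:
  assumes "\<epsilon> > 0" "c > 0"
    and "solves_bvp \<epsilon> b c l r g A B u" "AE x in lebesgue_on {l<..<r}. g x \<le> F"
    and "A \<le> K" "B \<le> K" "F \<le> c * K" "x \<in> {l..r}"
  shows "u x \<le> K"
  using bvp_comparison[OF assms(1-4), of "\<lambda>_. K" "\<lambda>_. 0" "\<lambda>_. 0" x] assms by auto

lemma AE_lebesgue_on_subset:
  assumes "AE x in lebesgue_on {l<..<r}. P x" "l \<le> l'" "r' \<le> r"
  shows "AE x in lebesgue_on {l'<..<r'::real}. P x"
proof -
  have "AE x in lebesgue. x \<in> {l<..<r} \<longrightarrow> P x"
    using assms(1) by (subst (asm) AE_restrict_space_iff) auto
  then have "AE x in lebesgue. x \<in> {l'<..<r'} \<longrightarrow> P x"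
    by eventually_elim (use assms(2,3) in auto)
  then show ?thesis
    by (subst AE_restrict_space_iff) auto
qed

section \<open>Estimate of the interface value\<close>

lemma interface_value_le:
  assumes pos: "\<epsilon> > 0" "\<epsilon> \<le> 1" "b > 0" "c > 0" "d \<ge> 0" "F \<ge> 0"
    and f: "AE x in lebesgue_on {0<..<2}. \<bar>f x\<bar> \<le> F"
    and u1: "solves_bvp \<epsilon> b c 0 1 f 0 \<alpha> u1"
    and u2: "solves_bvp \<epsilon> b c 1 2 (\<lambda>x. f x - d * u1 (x - 1)) (\<alpha> + \<delta>) \<beta> u2"
    and L: "(deriv u1 \<longlongrightarrow> L) (at_left 1)" "(deriv u2 \<longlongrightarrow> L) (at_right 1)"
  shows "\<alpha> \<le> (F + d * F / b) / c + \<bar>\<beta>\<bar> + \<bar>\<delta>\<bar> + F / b\<^sup>2"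
proof -
  \<comment> \<open>\<open>G\<close> bounds \<open>f x - d * u1 (x - 1)\<close> from above, since
    -u1 will be at most F/b.\<close>
  define G where "G = F + d * F / b"
  \<comment> \<open>A constant of this size dominates both the right-hand side \<open>G\<close> and
    the boundary value \<beta> of the second problem.\<close>
  define N where "N = G / c + \<bar>\<beta>\<bar>"
  have G: "G \<ge> 0"
    using pos by (simp add: G_def)
  then have "G / c \<ge> 0" "c * N = G + c * \<bar>\<beta>\<bar>"
    using pos by (auto simp: N_def algebra_simps)
  then have N: "N \<ge> 0" "G \<le> c * N" "\<beta> \<le> N"
    using pos by (auto simp: N_def)
  have Fb: "F / b\<^sup>2 \<ge> 0"
    using pos by simp
  show ?thesis
  \<comment> \<open>If the condition fails, either \<alpha> is nonpositive or it is at most N +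
    |\<delta>|; both suffice because the bound is nonnegative.\<close>
  proof (cases "\<alpha> > 0 \<and> \<alpha> + \<delta> > N")
    case False
    then show ?thesis
      using N(1) Fb unfolding N_def G_def by linarith
  next
    case True
    have f1: "AE x in lebesgue_on {0<..<1}. f x \<le> F" "AE x in lebesgue_on {0<..<1}. - f x \<le> F"
      using AE_lebesgue_on_subset[OF f, of 0 1] by auto
    have u1_ge: "- u1 x \<le> 0 + F / b * (1 - x)" if "x \<in> {0..1}" for x
      by (rule solves_bvp_le_linear[OF _ _ _ _ _ solves_bvp_uminus[OF u1] f1(2)])
        (use True pos that in auto)
    have u1_le: "u1 x \<le> \<alpha> + F / b * (1 - x)" if "x \<in> {0..1}" for x
      by (rule solves_bvp_le_linear[OF _ _ _ _ _ u1 f1(1)]) (use True pos that in auto)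
    have "- (F / b) \<le> L"
    proof (rule deriv_limit_at_left_ge[OF _ _ _ L(1), where S = "\<lambda>x. \<alpha> + F / b * (1 - x)"])
      show "((\<lambda>x. \<alpha> + F / b * (1 - x)) has_real_derivative - (F / b)) (at 1)"
        using pos by (auto intro!: derivative_eq_intros)
    qed (use u1 u1_le solves_bvp_differentiable[OF u1] in \<open>auto simp: solves_bvp_def\<close>)
    \<comment> \<open>With this rate the layer function exp(-s(x-1)) is annihilated by the diffusion
      and convection terms together. The assumption \<epsilon> \<le> 1 enters here, as
      \<open>b \<le> s\<close>.\<close>
    define s where "s = b / \<epsilon>"
    have s: "s > 0" "\<epsilon> * s = b" "b \<le> s"
      using pos by (auto simp: s_def field_simps)
    define K where "K = \<alpha> + \<delta> - N"
    have K: "K > 0"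
      using True by (simp add: K_def)
    define S where "S x = N + K * exp (- s * (x - 1))" for x
    define S' where "S' x = - s * K * exp (- s * (x - 1))" for x
    define S'' where "S'' x = s * s * K * exp (- s * (x - 1))" for x
    have SD: "(S has_real_derivative S' x) (at x)" "(S' has_real_derivative S'' x) (at x)" for x
      unfolding S_def S'_def S''_def by (auto intro!: derivative_eq_intros)
    have SN: "N \<le> S x" for x
      using K by (simp add: S_def)
    have LS: "- \<epsilon> * S'' x - b * S' x + c * S x = c * S x" for x
      unfolding S''_def S'_def s(2)[symmetric] by simp
    have f2: "AE x in lebesgue_on {1<..<2}. f x - d * u1 (x - 1) \<le> G"
    proof -
      have "AE x in lebesgue_on {1<..<2}. \<bar>f x\<bar> \<le> F"
        using AE_lebesgue_on_subset[OF f, of 1 2] by simp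
      then show ?thesis
        using AE_space
      proof eventually_elim
        case (elim x)
        then have x: "x - 1 \<in> {0..1}"
          by auto
        have "- u1 (x - 1) \<le> F / b * (1 - (x - 1))"
          using u1_ge[OF x] by simp
        also have "\<dots> \<le> F / b * 1"
          using x pos by (intro mult_left_mono) auto
        finally have "d * - u1 (x - 1) \<le> d * (F / b)"
          using pos by (intro mult_left_mono) auto
        then show ?case
          using elim(1) by (simp add: G_def)
      qed
    qed
    have u2_le: "u2 x \<le> S x" if "x \<in> {1..2}" for x
    proof (rule bvp_comparison[OF pos(1,4) u2 f2 SD])
      show "G \<le> - \<epsilon> * S'' x - b * S' x + c * S x" for x
        unfolding LS using mult_left_mono[OF SN[of x], of c] N(2) pos by linarith
      show "\<alpha> + \<delta> \<le> S 1" "\<beta> \<le> S 2"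
        using N(3) SN[of 2] by (auto simp: S_def K_def)
    qed (use that in auto)
    have "L \<le> S' 1"
    proof (rule deriv_limit_at_right_le[OF _ _ _ L(2) SD(1)])
      show "u2 1 = S 1"
        using u2 by (simp add: solves_bvp_def S_def K_def)
    qed (use u2 u2_le solves_bvp_differentiable[OF u2] in \<open>auto simp: solves_bvp_def\<close>)
    \<comment> \<open>The slopes combine to -F/b \<le> L \<le> S'(1) = -sK; replacing
      \<open>s\<close> by its lower bound \<open>b\<close> removes \<epsilon>.\<close>
    then have "s * K \<le> F / b"
      using \<open>- (F / b) \<le> L\<close> by (simp add: S'_def)
    moreover have "b * K \<le> s * K"
      using s K by (intro mult_right_mono) auto
    ultimately have "b * K \<le> F / b"
      by linarith
    then have "K \<le> F / b\<^sup>2"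
      using pos by (simp add: field_simps power2_eq_square)
    then show ?thesis
      unfolding K_def N_def G_def by (simp add: abs_if split: if_splits)
  qed
qed

text \<open>The bound is even in the data, so the one-sided estimate also applies to the negated
  problem, whose common slope is -L.\<close>

lemma abs_interface_value_le:
  assumes pos: "\<epsilon> > 0" "\<epsilon> \<le> 1" "b > 0" "c > 0" "d \<ge> 0" "F \<ge> 0"
    and f: "AE x in lebesgue_on {0<..<2}. \<bar>f x\<bar> \<le> F"
    and u1: "solves_bvp \<epsilon> b c 0 1 f 0 \<alpha> u1"
    and u2: "solves_bvp \<epsilon> b c 1 2 (\<lambda>x. f x - d * u1 (x - 1)) (\<alpha> + \<delta>) \<beta> u2"
    and L: "(deriv u1 \<longlongrightarrow> L) (at_left 1)" "(deriv u2 \<longlongrightarrow> L) (at_right 1)"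
  shows "\<bar>\<alpha>\<bar> \<le> (F + d * F / b) / c + \<bar>\<beta>\<bar> + \<bar>\<delta>\<bar> + F / b\<^sup>2"
proof -
  have dm: "deriv (\<lambda>x. - u x) y = - deriv u y" if "u differentiable (at y)" for u :: "real \<Rightarrow> real" and y
    using that by (intro DERIV_imp_deriv DERIV_minus has_deriv_if_differentiable)
  have ev: "\<forall>\<^sub>F y in at_left (1::real). y \<in> {0<..<1}" "\<forall>\<^sub>F y in at_right (1::real). y \<in> {1<..<2}"
    by (rule eventually_at_left_real eventually_at_right_real; simp)+
  have "- \<alpha> \<le> (F + d * F / b) / c + \<bar>- \<beta>\<bar> + \<bar>- \<delta>\<bar> + F / b\<^sup>2"
  proof (rule interface_value_le[OF pos, of "\<lambda>x. - f x" _ "\<lambda>x. - u1 x" "- \<delta>" "- \<beta>" "\<lambda>x. - u2 x" "- L"])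
    show "solves_bvp \<epsilon> b c 1 2 (\<lambda>x. - f x - d * - u1 (x - 1)) (- \<alpha> + - \<delta>) (- \<beta>) (\<lambda>x. - u2 x)"
      using solves_bvp_uminus[OF u2] by (simp add: algebra_simps)
    show "(deriv (\<lambda>x. - u1 x) \<longlongrightarrow> - L) (at_left 1)"
    proof (rule Lim_transform_eventually[OF tendsto_minus[OF L(1)]])
      show "\<forall>\<^sub>F y in at_left 1. - deriv u1 y = deriv (\<lambda>x. - u1 x) y"
        using ev(1) by eventually_elim (simp add: dm solves_bvp_differentiable[OF u1])
    qed
    show "(deriv (\<lambda>x. - u2 x) \<longlongrightarrow> - L) (at_right 1)"
    proof (rule Lim_transform_eventually[OF tendsto_minus[OF L(2)]])
      show "\<forall>\<^sub>F y in at_right 1. - deriv u2 y = deriv (\<lambda>x. - u2 x) y"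
        using ev(2) by eventually_elim (simp add: dm solves_bvp_differentiable[OF u2])
    qed
  qed (use f solves_bvp_uminus[OF u1] in auto)
  then show ?thesis
    using interface_value_le[OF assms] by (simp add: abs_le_iff)
qed

section \<open>Bounds on both pieces\<close>

text \<open>Once \<alpha> is bounded by k1 R, the pieces are separate Dirichlet problems. The linear
  barrier on (0, 1) adds 1/b to give \<open>k2\<close>; in \<open>k3\<close>, the part k1 + 1 covers
  the boundary values on (1, 2) and the quotient by \<open>c\<close> covers the right-hand side
  including the delayed term.\<close>

lemma coupled_solution_bound:
  assumes pos: "\<epsilon> > 0" "\<epsilon> \<le> 1" "b > 0" "c > 0" "d \<ge> 0" "F \<ge> 0"
    and f: "AE x in lebesgue_on {0<..<2}. \<bar>f x\<bar> \<le> F"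
    and u1: "solves_bvp \<epsilon> b c 0 1 f 0 \<alpha> u1"
    and u2: "solves_bvp \<epsilon> b c 1 2 (\<lambda>x. f x - d * u1 (x - 1)) (\<alpha> + \<delta>) \<beta> u2"
    and L: "(deriv u1 \<longlongrightarrow> L) (at_left 1)" "(deriv u2 \<longlongrightarrow> L) (at_right 1)"
  defines "k1 \<equiv> (1 + d / b) / c + 1 + 1 / b\<^sup>2"
  defines "k2 \<equiv> k1 + 1 / b"
  defines "k3 \<equiv> k1 + 1 + (1 + d * k2) / c"
  defines "R \<equiv> F + \<bar>\<beta>\<bar> + \<bar>\<delta>\<bar>"
  shows "x \<in> {0..1} \<Longrightarrow> \<bar>u1 x\<bar> \<le> k2 * R" and "x \<in> {1..2} \<Longrightarrow> \<bar>u2 x\<bar> \<le> k3 * R"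
proof -
  have R: "F \<le> R" "\<bar>\<beta>\<bar> + \<bar>\<delta>\<bar> \<le> R" "0 \<le> R"
    using pos by (auto simp: R_def)
  have \<alpha>: "\<bar>\<alpha>\<bar> \<le> k1 * R"
  proof -
    have "\<bar>\<alpha>\<bar> \<le> (F + d * F / b) / c + \<bar>\<beta>\<bar> + \<bar>\<delta>\<bar> + F / b\<^sup>2"
      by (rule abs_interface_value_le[OF pos f u1 u2 L])
    also have "\<dots> = (1 + d / b) / c * F + (\<bar>\<beta>\<bar> + \<bar>\<delta>\<bar>) + 1 / b\<^sup>2 * F"
      by (simp add: algebra_simps add_divide_distrib)
    also have "\<dots> \<le> (1 + d / b) / c * R + R + 1 / b\<^sup>2 * R"
      using pos R by (intro add_mono mult_left_mono) auto
    also have "\<dots> = k1 * R"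
      by (simp add: k1_def algebra_simps)
    finally show ?thesis .
  qed
  have k: "0 \<le> k1" "0 \<le> k2" "0 \<le> k3"
    using pos by (auto simp: k1_def k2_def k3_def)
  have Fb: "F / b \<le> 1 / b * R"
    using pos R by (simp add: divide_right_mono)
  have f1: "AE x in lebesgue_on {0<..<1}. f x \<le> F" "AE x in lebesgue_on {0<..<1}. - f x \<le> F"
    using AE_lebesgue_on_subset[OF f, of 0 1] by auto
  have u1_bound: "\<bar>u1 x\<bar> \<le> k2 * R" if x: "x \<in> {0..1}" for x
  proof -
    have "u1 x \<le> \<bar>\<alpha>\<bar> + F / b * (1 - x)"
      by (rule solves_bvp_le_linear[OF _ _ _ _ _ u1 f1(1)]) (use pos x in auto)
    moreover have "- u1 x \<le> \<bar>\<alpha>\<bar> + F / b * (1 - x)"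
      by (rule solves_bvp_le_linear[OF _ _ _ _ _ solves_bvp_uminus[OF u1] f1(2)]) (use pos x in auto)
    moreover have "F / b * (1 - x) \<le> F / b * 1"
      using pos x by (intro mult_left_mono) auto
    ultimately show ?thesis
      using \<alpha> Fb by (simp add: k2_def algebra_simps)
  qed
  then show "x \<in> {0..1} \<Longrightarrow> \<bar>u1 x\<bar> \<le> k2 * R" .
  have f2: "AE x in lebesgue_on {1<..<2}. \<bar>f x - d * u1 (x - 1)\<bar> \<le> (1 + d * k2) * R"
  proof -
    have "AE x in lebesgue_on {1<..<2}. \<bar>f x\<bar> \<le> F"
      using AE_lebesgue_on_subset[OF f, of 1 2] by simp
    then show ?thesis
      using AE_space
    proof eventually_elim
      case (elim x)
      then have "\<bar>d * u1 (x - 1)\<bar> \<le> d * (k2 * R)"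
        unfolding abs_mult using pos u1_bound[of "x - 1"] by (intro mult_mono) auto
      then show ?case
        using elim(1) R(1) by (simp add: algebra_simps)
    qed
  qed
  have ck: "(1 + d * k2) * R \<le> c * (k3 * R)"
  proof -
    have "(1 + d * k2) \<le> c * k3"
      using pos k by (simp add: k3_def field_simps)
    from mult_right_mono[OF this R(3)] show ?thesis
      by (simp add: mult.assoc)
  qed
  have "(k1 + 1) * R \<le> k3 * R"
    using pos k R by (intro mult_right_mono) (auto simp: k3_def)
  then have bd: "\<bar>\<alpha>\<bar> + \<bar>\<delta>\<bar> \<le> k3 * R" "\<bar>\<beta>\<bar> \<le> k3 * R"
    using \<alpha> R k mult_nonneg_nonneg[OF k(1) R(3)] by (auto simp: algebra_simps)
  show "\<bar>u2 x\<bar> \<le> k3 * R" if x: "x \<in> {1..2}"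
  proof -
    have "u2 x \<le> k3 * R"
      by (rule solves_bvp_le_const[OF pos(1,4) u2 _ _ _ ck]) (use bd f2 x in auto)
    moreover have "- u2 x \<le> k3 * R"
      by (rule solves_bvp_le_const[OF pos(1,4) solves_bvp_uminus[OF u2] _ _ _ ck]) (use bd f2 x in auto)
    ultimately show ?thesis
      by simp
  qed
qed

section \<open>Passage to essential suprema\<close>

text \<open>Since \<open>l < r\<close>, the interval has positive measure, so the zero function has
  essential supremum 0 and the norm is a nonnegative real.\<close>

lemma Linf_norm_AE_bound:
  assumes "f \<in> Linf l r" "l < r"
  obtains F where "0 \<le> F" "Linf_norm l r f = ereal F" "AE x in lebesgue_on {l<..<r}. \<bar>f x\<bar> \<le> F"
proof -
  have m: "f \<in> borel_measurable (lebesgue_on {l<..<r})" and fin: "Linf_norm l r f < \<infinity>"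
    using assms(1) by (auto simp: Linf_def)
  have "emeasure (lebesgue_on {l<..<r}) (space (lebesgue_on {l<..<r})) \<noteq> 0"
    using assms(2) by (simp add: emeasure_restrict_space)
  then have "esssup (lebesgue_on {l<..<r}) (\<lambda>x. 0::ereal) = 0"
    by (rule esssup_const)
  moreover have "esssup (lebesgue_on {l<..<r}) (\<lambda>x. 0::ereal) \<le> Linf_norm l r f"
    unfolding Linf_norm_def by (rule esssup_mono) auto
  ultimately have "0 \<le> Linf_norm l r f"
    by simp
  then obtain F where F: "Linf_norm l r f = ereal F" "0 \<le> F"
    using fin by (cases "Linf_norm l r f") auto
  have "AE x in lebesgue_on {l<..<r}. ereal \<bar>f x\<bar> \<le> Linf_norm l r f"
    unfolding Linf_norm_def by (rule esssup_AE)
  then have "AE x in lebesgue_on {l<..<r}. \<bar>f x\<bar> \<le> F"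
    unfolding F(1) by simp
  with F that show ?thesis
    by blast
qed

lemma Linf_norm_glue_le:
  fixes u1 u2 :: "real \<Rightarrow> real"
  assumes "continuous_on {l..m} u1" "continuous_on {m..r} u2" "l \<le> m" "m \<le> r" "0 \<le> K"
    and "\<And>x. x \<in> {l..m} \<Longrightarrow> \<bar>u1 x\<bar> \<le> K" "\<And>x. x \<in> {m..r} \<Longrightarrow> \<bar>u2 x\<bar> \<le> K"
  shows "Linf_norm l r (\<lambda>x. u1 x * indicator {l<..<m} x + u2 x * indicator {m<..<r} x) \<le> ereal K"
  unfolding Linf_norm_def
proof (rule esssup_I)
  have "(\<lambda>x. u1 x * indicator {l<..<m} x) \<in> borel_measurable lborel"
    using borel_measurable_continuous_on_indicator[of "{l<..<m}" u1]
      continuous_on_subset[OF assms(1), of "{l<..<m}"]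
    by (force simp: mult.commute)
  moreover have "(\<lambda>x. u2 x * indicator {m<..<r} x) \<in> borel_measurable lborel"
    using borel_measurable_continuous_on_indicator[of "{m<..<r}" u2]
      continuous_on_subset[OF assms(2), of "{m<..<r}"]
    by (force simp: mult.commute)
  ultimately have "(\<lambda>x. u1 x * indicator {l<..<m} x + u2 x * indicator {m<..<r} x) \<in> borel_measurable (lebesgue_on {l<..<r})"
    by (intro measurable_restrict_space1 measurable_completion borel_measurable_add)
  then show "(\<lambda>x. ereal \<bar>u1 x * indicator {l<..<m} x + u2 x * indicator {m<..<r} x\<bar>)
      \<in> borel_measurable (lebesgue_on {l<..<r})"
    by measurable
  \<comment> \<open>At \<open>m\<close> both indicators vanish, and the bound there is
    \<open>0 \<le> K\<close>.\<close>
  show "AE x in lebesgue_on {l<..<r}. ereal \<bar>u1 x * indicator {l<..<m} x + u2 x * indicator {m<..<r} x\<bar> \<le> ereal K"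
    using assms(5-) by (intro AE_I2) (auto simp: indicator_def)
qed

theorem theorem2p1:
  fixes b c d :: real
  assumes "b > 0" and "c > 0" and "d \<ge> 0"
  shows "\<exists>\<epsilon>\<^sub>0 > 0. \<exists>C > 0. \<forall>\<epsilon> \<in> {0<..\<epsilon>\<^sub>0}. \<forall>f \<in> Linf 0 2. \<forall>\<beta> \<delta> \<alpha> :: real. \<forall>u\<^sub>1 u\<^sub>2 :: real \<Rightarrow> real.
    solves_bvp \<epsilon> b c 0 1 f 0 \<alpha> u\<^sub>1 \<longrightarrow>
    solves_bvp \<epsilon> b c 1 2 (\<lambda>x. f x - d * u\<^sub>1 (x - 1)) (\<alpha> + \<delta>) \<beta> u\<^sub>2 \<longrightarrow>
    (\<exists>L. (deriv u\<^sub>1 \<longlongrightarrow> L) (at_left 1) \<and> (deriv u\<^sub>2 \<longlongrightarrow> L) (at_right 1)) \<longrightarrow>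
    Linf_norm 0 2 (\<lambda>x. u\<^sub>1 x * indicator {0<..<1} x + u\<^sub>2 x * indicator {1<..<2} x)
      \<le> ereal C * (Linf_norm 0 2 f + ereal \<bar>\<beta>\<bar> + ereal \<bar>\<delta>\<bar>)"
proof -
  define k1 where "k1 = (1 + d / b) / c + 1 + 1 / b\<^sup>2"
  define k2 where "k2 = k1 + 1 / b"
  define k3 where "k3 = k1 + 1 + (1 + d * k2) / c"
  have k: "k1 > 0" "k2 > 0" "k3 > 0"
    using assms by (auto simp: k1_def k2_def k3_def intro!: add_nonneg_pos add_pos_nonneg divide_pos_pos)
  show ?thesis
  \<comment> \<open>The threshold 1 is what the layer estimate needs, and the sum of
    \<open>k2\<close> and \<open>k3\<close> dominates the bounds on both pieces.\<close>
  proof (rule exI[of _ 1], intro conjI exI[of _ "k2 + k3"] ballI allI impI)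
    fix \<epsilon> f \<beta> \<delta> \<alpha> and u1 u2 :: "real \<Rightarrow> real"
    assume \<epsilon>: "\<epsilon> \<in> {0<..1}" and f: "f \<in> Linf 0 2"
      and u: "solves_bvp \<epsilon> b c 0 1 f 0 \<alpha> u1"
        "solves_bvp \<epsilon> b c 1 2 (\<lambda>x. f x - d * u1 (x - 1)) (\<alpha> + \<delta>) \<beta> u2"
      and "\<exists>L. (deriv u1 \<longlongrightarrow> L) (at_left 1) \<and> (deriv u2 \<longlongrightarrow> L) (at_right 1)"
    then obtain L where L: "(deriv u1 \<longlongrightarrow> L) (at_left 1)" "(deriv u2 \<longlongrightarrow> L) (at_right 1)"
      by blast
    obtain F where F: "0 \<le> F" "Linf_norm 0 2 f = ereal F" "AE x in lebesgue_on {0<..<2}. \<bar>f x\<bar> \<le> F"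
      using Linf_norm_AE_bound[OF f] by auto
    define R where "R = F + \<bar>\<beta>\<bar> + \<bar>\<delta>\<bar>"
    have R: "0 \<le> R"
      using F by (simp add: R_def)
    have \<epsilon>': "\<epsilon> > 0" "\<epsilon> \<le> 1"
      using \<epsilon> by auto
    note bound = coupled_solution_bound[OF \<epsilon>' assms F(1,3) u L,
        folded k1_def, folded k2_def, folded k3_def, folded R_def]
    have le: "k2 * R \<le> (k2 + k3) * R" "k3 * R \<le> (k2 + k3) * R"
      using k R by (auto intro!: mult_right_mono)
    have "Linf_norm 0 2 (\<lambda>x. u1 x * indicator {0<..<1} x + u2 x * indicator {1<..<2} x)
        \<le> ereal ((k2 + k3) * R)"
      by (rule Linf_norm_glue_le)
        (use u k R in \<open>auto simp: solves_bvp_def intro: order_trans[OF bound(1) le(1)] order_trans[OF bound(2) le(2)]\<close>)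
    then show "Linf_norm 0 2 (\<lambda>x. u1 x * indicator {0<..<1} x + u2 x * indicator {1<..<2} x)
        \<le> ereal (k2 + k3) * (Linf_norm 0 2 f + ereal \<bar>\<beta>\<bar> + ereal \<bar>\<delta>\<bar>)"
      by (simp add: F(2) R_def)
  qed (use k in auto)
qed

end
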